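(* Let $A\in\mathbb{R}^{k\times n}$, $y\in\mathbb{R}^k$, $\lambda\ge 0$, and $\mu>0$, and consider the constrained sparse regression problem $$\min_{x\in\mathbb{R}^n}\ \tfrac12\|Ax-y\|_2^2+\lambda\|x\|_1\quad\text{subject to } x\ge 0 .$$ This problem has a non-empty set of minimizers. Moreover, for arbitrary $u_0,d_0\in\mathbb{R}^n$, let the sequences $\{x_j\},\{u_j\},\{d_j\}$ in $\mathbb{R}^n$ be generated, for $j=0,1,2,\dots$, by the SUnSAL iteration $$x_{j+1}=(A^TA+\mu I)^{-1}\bigl(A^Ty+\mu(u_j+d_j)\bigr),$$ $$u_{j+1}=\max\{0,\operatorname{soft}(x_{j+1}-d_j,\lambda/\mu)\},$$ $$d_{j+1}=d_j-(x_{j+1}-u_{j+1}).$$ Then $\{x_j\}$ converges to a solution of the constrained sparse regression problem.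
   Context: The inequality $x\ge 0$ and the maximum with $0$ are componentwise. The soft threshold with parameter $\tau\ge 0$ acts componentwise on a vector $v$ by $\operatorname{soft}(v,\tau)_i=\operatorname{sign}(v_i)\max\{|v_i|-\tau,0\}$. $\|\cdot\|_2$ and $\|\cdot\|_1$ are the $\ell_2$ and $\ell_1$ norms, and $I$ is the identity matrix. *)

theory Defs
  imports "HOL-Analysis.Analysis"
begin

definition l1_norm :: "real ^ 'n \<Rightarrow> real" where
  "l1_norm x = (\<Sum>i\<in>UNIV. \<bar>x $ i\<bar>)"

definition soft :: "real ^ 'n \<Rightarrow> real \<Rightarrow> real ^ 'n" where
  "soft v \<tau> = (\<chi> i. sgn (v $ i) * max (\<bar>v $ i\<bar> - \<tau>) 0)"

definition pos_part :: "real ^ 'n \<Rightarrow> real ^ 'n" where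
  "pos_part v = (\<chi> i. max 0 (v $ i))"

definition csr_objective :: "real ^ 'n ^ 'k \<Rightarrow> real ^ 'k \<Rightarrow> real \<Rightarrow> real ^ 'n \<Rightarrow> real" where
  "csr_objective A y lam x = 1 / 2 * (norm (A *v x - y))\<^sup>2 + lam * l1_norm x"

(* The order on real ^ 'n is the componentwise one (less_eq_vec_def). *)
definition csr_solutions :: "real ^ 'n ^ 'k \<Rightarrow> real ^ 'k \<Rightarrow> real \<Rightarrow> (real ^ 'n) set" where
  "csr_solutions A y lam = {x. is_arg_min (csr_objective A y lam) (\<lambda>z. 0 \<le> z) x}"

(* x 0 is left unconstrained: the recursion never uses it. *)
definition sunsal_iteration ::
  "real ^ 'n ^ 'k \<Rightarrow> real ^ 'k \<Rightarrow> real \<Rightarrow> real \<Rightarrow> real ^ 'n \<Rightarrow> real ^ 'n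
    \<Rightarrow> (nat \<Rightarrow> real ^ 'n) \<Rightarrow> (nat \<Rightarrow> real ^ 'n) \<Rightarrow> (nat \<Rightarrow> real ^ 'n) \<Rightarrow> bool" where
  "sunsal_iteration A y lam \<mu> u0 d0 x u d \<longleftrightarrow>
     u 0 = u0 \<and> d 0 = d0 \<and>
     (\<forall>j.
        x (Suc j) = matrix_inv (transpose A ** A + \<mu> *\<^sub>R mat 1) *v
                      (transpose A *v y + \<mu> *\<^sub>R (u j + d j)) \<and>
        u (Suc j) = pos_part (soft (x (Suc j) - d j) (lam / \<mu>)) \<and>
        d (Suc j) = d j - (x (Suc j) - u (Suc j)))"

end

theory Submission
  imports Defs
begin

text \<open>
  SUnSAL is the Douglas--Rachford iteration in disguise. Put \<open>v\<^sub>j = x\<^sub>j\<^sub>+\<^sub>1 - d\<^sub>j\<close>. The \<open>u\<close>-step is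
  \<open>u\<^sub>j\<^sub>+\<^sub>1 = P v\<^sub>j\<close>, where \<open>P\<close> is the proximal map of the penalty plus the constraint, hence
  \<open>d\<^sub>j\<^sub>+\<^sub>1 = P v\<^sub>j - v\<^sub>j\<close>; the next \<open>x\<close>-step applies the proximal map \<open>R\<close> of the least-squares term
  to \<open>u\<^sub>j\<^sub>+\<^sub>1 + d\<^sub>j\<^sub>+\<^sub>1 = 2 P v\<^sub>j - v\<^sub>j\<close>. So \<open>v\<^sub>j\<^sub>+\<^sub>1 = T v\<^sub>j\<close> with \<open>T v = R (2 P v - v) + v - P v\<close>, which is firmly
  nonexpansive because \<open>P\<close> and \<open>R\<close> are. Iterates of such a map converge to a fixed point as soon
  as one exists, and \<open>P\<close> maps the fixed points of \<open>T\<close> onto the minimizers. A minimizer exists for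
  \<open>\<lambda> > 0\<close> by coercivity and for \<open>\<lambda> = 0\<close> because the image of the orthant is a finitely generated,
  hence closed, cone.
\<close>

section \<open>Firmly nonexpansive maps\<close>

text \<open>The inequality satisfied by proximal maps. It is stronger than being 1-Lipschitz, and
  the surplus is what makes plain iteration converge without averaging.\<close>

definition firmly_nonexpansive :: "('a::real_inner \<Rightarrow> 'a) \<Rightarrow> bool" where
  "firmly_nonexpansive T \<longleftrightarrow> (\<forall>x y. (norm (T x - T y))\<^sup>2 \<le> (T x - T y) \<bullet> (x - y))"

lemma firmly_nonexpansiveD:
  "firmly_nonexpansive T \<Longrightarrow> (norm (T x - T y))\<^sup>2 \<le> (T x - T y) \<bullet> (x - y)"
  unfolding firmly_nonexpansive_def by blast

lemma firmly_nonexpansive_norm_le: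
  assumes "firmly_nonexpansive T"
  shows "norm (T x - T y) \<le> norm (x - y)"
proof (cases "norm (T x - T y) = 0")
  case False
  have "norm (T x - T y) * norm (T x - T y) \<le> norm (T x - T y) * norm (x - y)"
    using firmly_nonexpansiveD[OF assms, of x y] norm_cauchy_schwarz[of "T x - T y" "x - y"]
    by (simp add: power2_eq_square)
  with False show ?thesis by simp
qed simp

lemma firmly_nonexpansive_tendsto:
  assumes "firmly_nonexpansive T" and "(f \<longlongrightarrow> l) F"
  shows "((\<lambda>x. T (f x)) \<longlongrightarrow> T l) F"
proof -
  have "((\<lambda>x. f x - l) \<longlongrightarrow> 0) F" using assms(2) by (simp add: LIM_zero)
  then have "((\<lambda>x. T (f x) - T l) \<longlongrightarrow> 0) F"
    by (rule Lim_null_comparison[rotated, OF tendsto_norm_zero])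
      (simp add: firmly_nonexpansive_norm_le[OF assms(1)])
  then show ?thesis by (rule LIM_zero_cancel)
qed

text \<open>With the differences \<open>a\<close>, \<open>p\<close>, \<open>r\<close> of the proof,
  the slack in the claim is exactly the sum of the slacks in the two inequalities for
  \<open>P\<close> and \<open>R\<close>.\<close>

lemma firmly_nonexpansive_Douglas_Rachford:
  fixes P R :: "'a::real_inner \<Rightarrow> 'a"
  assumes P: "firmly_nonexpansive P" and R: "firmly_nonexpansive R"
  shows "firmly_nonexpansive (\<lambda>v. R (2 *\<^sub>R P v - v) + v - P v)"
  unfolding firmly_nonexpansive_def
proof (intro allI)
  fix x y :: 'a
  define a where "a = x - y"
  define p where "p = P x - P y"
  define r where "r = R (2 *\<^sub>R P x - x) - R (2 *\<^sub>R P y - y)"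
  have "p \<bullet> p \<le> p \<bullet> a"
    using firmly_nonexpansiveD[OF P, of x y] by (simp add: a_def p_def power2_norm_eq_inner)
  moreover have "(2 *\<^sub>R P x - x) - (2 *\<^sub>R P y - y) = 2 *\<^sub>R p - a"
    by (simp add: a_def p_def algebra_simps)
  then have "r \<bullet> r \<le> r \<bullet> (2 *\<^sub>R p - a)"
    using firmly_nonexpansiveD[OF R, of "2 *\<^sub>R P x - x" "2 *\<^sub>R P y - y"]
    by (simp add: r_def power2_norm_eq_inner)
  ultimately have "(r + a - p) \<bullet> (r + a - p) \<le> (r + a - p) \<bullet> a"
    by (simp add: inner_diff inner_add inner_commute algebra_simps)
  moreover have "R (2 *\<^sub>R P x - x) + x - P x - (R (2 *\<^sub>R P y - y) + y - P y) = r + a - p"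
    by (simp add: a_def p_def r_def)
  ultimately show "(norm (R (2 *\<^sub>R P x - x) + x - P x - (R (2 *\<^sub>R P y - y) + y - P y)))\<^sup>2
      \<le> (R (2 *\<^sub>R P x - x) + x - P x - (R (2 *\<^sub>R P y - y) + y - P y)) \<bullet> (x - y)"
    by (simp only: a_def[symmetric] power2_norm_eq_inner)
qed

text \<open>Expanding the square of \<open>x - p = (T x - p) + (x - T x)\<close> leaves a cross term
  that firm nonexpansiveness makes nonnegative.\<close>

lemma firmly_nonexpansive_fixpoint_dist:
  assumes "firmly_nonexpansive T" and "T p = p"
  shows "(norm (T x - p))\<^sup>2 + (norm (T x - x))\<^sup>2 \<le> (norm (x - p))\<^sup>2"
proof -
  have "(norm (T x - p))\<^sup>2 \<le> (T x - p) \<bullet> (x - p)"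
    using firmly_nonexpansiveD[OF assms(1), of x p] assms(2) by simp
  then show ?thesis
    by (simp add: power2_norm_eq_inner inner_diff inner_add inner_commute algebra_simps)
qed

text \<open>Fejer monotonicity: the distance to every fixed point decreases, so the orbit is bounded
  and its steps tend to zero. By continuity of \<open>T\<close> a cluster point is then itself a
  fixed point.\<close>

lemma firmly_nonexpansive_iterates_converge:
  fixes T :: "'a::euclidean_space \<Rightarrow> 'a"
  assumes T: "firmly_nonexpansive T" and p: "T p = p" and v: "\<And>n. v (Suc n) = T (v n)"
  obtains q where "T q = q" and "v \<longlonglongrightarrow> q"
proof -
  have Fejer: "(norm (v (Suc n) - q))\<^sup>2 + (norm (v (Suc n) - v n))\<^sup>2 \<le> (norm (v n - q))\<^sup>2"
    if "T q = q" for q n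
    using firmly_nonexpansive_fixpoint_dist[OF T that, of "v n"] by (simp add: v)
  have dec: "decseq (\<lambda>n. (norm (v n - q))\<^sup>2)" if "T q = q" for q
    using Fejer[OF that] by (intro decseq_SucI) (smt (verit) zero_le_power2)
  have conv: "\<exists>L. (\<lambda>n. (norm (v n - q))\<^sup>2) \<longlonglongrightarrow> L" if "T q = q" for q
    using decseq_convergent[OF dec[OF that], of 0] by auto
  obtain L where L: "(\<lambda>n. (norm (v n - p))\<^sup>2) \<longlonglongrightarrow> L"
    using conv[OF p] by blast
  have "(\<lambda>n. (norm (v n - p))\<^sup>2 - (norm (v (Suc n) - p))\<^sup>2) \<longlonglongrightarrow> 0"
    using tendsto_diff[OF L LIMSEQ_Suc[OF L]] by simp
  then have "(\<lambda>n. (norm (v (Suc n) - v n))\<^sup>2) \<longlonglongrightarrow> 0"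
    by (rule Lim_null_comparison[rotated])
      (use Fejer[OF p] in \<open>auto intro!: always_eventually simp: le_diff_eq add.commute\<close>)
  then have "(\<lambda>n. norm (v (Suc n) - v n)) \<longlonglongrightarrow> 0"
    using tendsto_real_sqrt by fastforce
  then have step: "(\<lambda>n. T (v n) - v n) \<longlonglongrightarrow> 0"
    by (simp add: tendsto_norm_zero_iff v)
  have "v n \<in> cball p (norm (v 0 - p))" for n
    using decseqD[OF dec[OF p], of 0 n] by (simp add: dist_norm norm_minus_commute)
  then obtain q r where r: "strict_mono r" and q: "(v \<circ> r) \<longlonglongrightarrow> q"
    using compact_cball[of p "norm (v 0 - p)"] unfolding compact_def by metis
  have "(\<lambda>n. T ((v \<circ> r) n) - (v \<circ> r) n) \<longlonglongrightarrow> T q - q"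
    by (intro tendsto_diff firmly_nonexpansive_tendsto[OF T] q)
  moreover have "(\<lambda>n. T ((v \<circ> r) n) - (v \<circ> r) n) \<longlonglongrightarrow> 0"
    using LIMSEQ_subseq_LIMSEQ[OF step r] by (simp add: o_def)
  ultimately have fixq: "T q = q"
    using LIMSEQ_unique by fastforce
  \<comment> \<open>Monotonicity is now applied to the cluster point \<open>q\<close> instead of
    \<open>p\<close>: the distances to \<open>q\<close> converge, and a subsequence of them tends to
    zero.\<close>
  obtain L' where L': "(\<lambda>n. (norm (v n - q))\<^sup>2) \<longlonglongrightarrow> L'"
    using conv[OF fixq] by blast
  have "(\<lambda>n. (norm ((v \<circ> r) n - q))\<^sup>2) \<longlonglongrightarrow> (norm (q - q))\<^sup>2"
    by (intro tendsto_intros q)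
  then have "L' = 0"
    using LIMSEQ_unique[OF LIMSEQ_subseq_LIMSEQ[OF L' r], of 0] by (simp add: o_def)
  with L' have "(\<lambda>n. norm (v n - q)) \<longlonglongrightarrow> 0"
    using tendsto_real_sqrt by fastforce
  then have "v \<longlonglongrightarrow> q"
    by (simp add: tendsto_norm_zero_iff LIM_zero_cancel)
  with fixq show thesis by (rule that)
qed

section \<open>The two proximal maps\<close>

lemma pos_part_nonneg: "0 \<le> pos_part a"
  by (simp add: less_eq_vec_def pos_part_def)

text \<open>The obtuse-angle property of the projection onto the orthant. In each coordinate either
  the first factor vanishes or it is negative and the second is \<open>w $ i\<close>.\<close>

lemma pos_part_inner_le:
  assumes "0 \<le> w"
  shows "(a - pos_part a) \<bullet> (w - pos_part a) \<le> 0"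
  unfolding inner_vec_def
proof (rule sum_nonpos)
  fix i
  have "0 \<le> w $ i" using assms by (simp add: less_eq_vec_def)
  then show "(a - pos_part a) $ i \<bullet> (w - pos_part a) $ i \<le> 0"
    by (auto simp: pos_part_def max_def mult_le_0_iff)
qed

text \<open>Testing each of the two variational inequalities at the other point and adding gives a
  squared distance that is at most zero.\<close>

lemma pos_part_unique:
  assumes "0 \<le> z" and "\<And>w. 0 \<le> w \<Longrightarrow> (a - z) \<bullet> (w - z) \<le> 0"
  shows "pos_part a = z"
proof -
  have "(a - z) \<bullet> (pos_part a - z) \<le> 0" "(a - pos_part a) \<bullet> (z - pos_part a) \<le> 0"
    using assms pos_part_nonneg pos_part_inner_le by blast+
  then have "(pos_part a - z) \<bullet> (pos_part a - z) \<le> 0"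
    by (simp add: inner_diff inner_add inner_commute algebra_simps)
  then show ?thesis
    by (metis inner_ge_zero inner_eq_zero_iff eq_iff_diff_eq_0 order_antisym)
qed

text \<open>Negative entries of \<open>v\<close> yield zero on both sides. The \<open>u\<close>-step
  thus becomes a projection of a shifted point, reflecting that the penalty is linear on the
  orthant.\<close>

lemma pos_part_soft: "0 \<le> \<tau> \<Longrightarrow> pos_part (soft v \<tau>) = pos_part (v - \<tau> *\<^sub>R 1)"
  by (auto simp: vec_eq_iff pos_part_def soft_def sgn_if max_def abs_if)

lemma firmly_nonexpansive_pos_part_shift: "firmly_nonexpansive (\<lambda>v :: real ^ 'n. pos_part (v - c))"
  unfolding firmly_nonexpansive_def
proof (intro allI)
  fix x y :: "real ^ 'n"
  have "(x - c - pos_part (x - c)) \<bullet> (pos_part (y - c) - pos_part (x - c)) \<le> 0"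
    "(y - c - pos_part (y - c)) \<bullet> (pos_part (x - c) - pos_part (y - c)) \<le> 0"
    by (intro pos_part_inner_le pos_part_nonneg)+
  then show "(norm (pos_part (x - c) - pos_part (y - c)))\<^sup>2
      \<le> (pos_part (x - c) - pos_part (y - c)) \<bullet> (x - y)"
    unfolding power2_norm_eq_inner by (simp add: inner_diff inner_add inner_commute algebra_simps)
qed

section \<open>The resolvent of the least-squares term\<close>

lemma inner_transpose_matrix:
  fixes A :: "real ^ 'n ^ 'k"
  shows "(transpose A *v p) \<bullet> q = p \<bullet> (A *v q)"
  by (simp add: dot_lmul_matrix)

lemma gram_shift_mult:
  fixes A :: "real ^ 'n ^ 'k"
  shows "(transpose A ** A + \<mu> *\<^sub>R mat 1) *v x = transpose A *v (A *v x) + \<mu> *\<^sub>R x"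
  by (simp add: matrix_vector_mult_add_rdistrib scaleR_matrix_vector_assoc[symmetric]
      matrix_vector_mul_assoc[symmetric] del: transpose_matrix_vector)

text \<open>Pairing a kernel vector \<open>x\<close> with its image gives
  \<open>(A *v x) \<bullet> (A *v x) + \<mu> * (x \<bullet> x) = 0\<close>, which forces
  \<open>x = 0\<close>.\<close>

lemma invertible_gram_shift:
  fixes A :: "real ^ 'n ^ 'k"
  assumes "\<mu> > 0"
  shows "invertible (transpose A ** A + \<mu> *\<^sub>R mat 1)"
proof -
  have "x = 0" if "(transpose A ** A + \<mu> *\<^sub>R mat 1) *v x = 0" for x
  proof -
    have "(transpose A *v (A *v x) + \<mu> *\<^sub>R x) \<bullet> x = 0"
      using that by (simp add: gram_shift_mult del: transpose_matrix_vector)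
    then have "(A *v x) \<bullet> (A *v x) + \<mu> * (x \<bullet> x) = 0"
      by (simp add: inner_add_left inner_transpose_matrix del: transpose_matrix_vector)
    then have "\<mu> * (x \<bullet> x) \<le> 0"
      using inner_ge_zero[of "A *v x"] by linarith
    with assms show ?thesis
      by (metis inner_eq_zero_iff inner_ge_zero mult_le_0_iff not_le order_antisym)
  qed
  then show ?thesis
    unfolding invertible_left_inverse matrix_left_invertible_ker by blast
qed

lemma matrix_inv_gram_shift_eq_iff:
  fixes A :: "real ^ 'n ^ 'k"
  assumes "\<mu> > 0"
  shows "matrix_inv (transpose A ** A + \<mu> *\<^sub>R mat 1) *v b = x \<longleftrightarrow>
    transpose A *v (A *v x) + \<mu> *\<^sub>R x = b"
proof -
  let ?M = "transpose A ** A + \<mu> *\<^sub>R mat 1"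
  have inv: "?M ** matrix_inv ?M = mat 1 \<and> matrix_inv ?M ** ?M = mat 1"
    using invertible_gram_shift[OF assms, of A] unfolding invertible_def matrix_inv_def
    by (rule someI_ex)
  have "matrix_inv ?M *v b = x \<longleftrightarrow> ?M *v x = b"
    by (metis inv matrix_vector_mul_assoc matrix_vector_mul_lid)
  then show ?thesis by (simp only: gram_shift_mult)
qed

text \<open>The difference \<open>r\<close> of two values solves the normal equation with right-hand
  side \<open>\<mu> *\<^sub>R (p - q)\<close>. Pair it with \<open>r\<close> and drop the
  nonnegative term from \<open>A *v r\<close>.\<close>

lemma firmly_nonexpansive_gram_resolvent:
  fixes A :: "real ^ 'n ^ 'k"
  assumes "\<mu> > 0"
  shows "firmly_nonexpansive
    (\<lambda>q. matrix_inv (transpose A ** A + \<mu> *\<^sub>R mat 1) *v (b + \<mu> *\<^sub>R q))"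
    (is "firmly_nonexpansive ?R")
  unfolding firmly_nonexpansive_def
proof (intro allI)
  fix p q :: "real ^ 'n"
  define r where "r = ?R p - ?R q"
  have eq: "transpose A *v (A *v ?R q) + \<mu> *\<^sub>R ?R q = b + \<mu> *\<^sub>R q" for q
    using matrix_inv_gram_shift_eq_iff[OF assms] by blast
  have "transpose A *v (A *v r) + \<mu> *\<^sub>R r = (transpose A *v (A *v ?R p) + \<mu> *\<^sub>R ?R p)
      - (transpose A *v (A *v ?R q) + \<mu> *\<^sub>R ?R q)"
    by (simp only: r_def matrix_vector_mult_diff_distrib scaleR_diff_right add_diff_add)
  also have "\<dots> = \<mu> *\<^sub>R (p - q)"
    by (simp only: eq scaleR_diff_right add_diff_cancel_left)
  finally have "(transpose A *v (A *v r) + \<mu> *\<^sub>R r) \<bullet> r = \<mu> * ((p - q) \<bullet> r)"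
    by (simp only: inner_scaleR_left)
  then have "(A *v r) \<bullet> (A *v r) + \<mu> * (r \<bullet> r) = \<mu> * (r \<bullet> (p - q))"
    by (simp only: inner_add_left inner_scaleR_left inner_transpose_matrix inner_commute[of "p - q"])
  then have "\<mu> * (r \<bullet> r) \<le> \<mu> * (r \<bullet> (p - q))"
    using inner_ge_zero[of "A *v r"] by linarith
  then show "(norm (?R p - ?R q))\<^sup>2 \<le> (?R p - ?R q) \<bullet> (p - q)"
    unfolding r_def[symmetric] using assms
    by (simp only: power2_norm_eq_inner mult_le_cancel_left_pos)
qed

section \<open>Minimizers\<close>

lemma l1_norm_nonneg_vec: "0 \<le> x \<Longrightarrow> l1_norm x = 1 \<bullet> x"
  by (simp add: l1_norm_def inner_vec_def less_eq_vec_def)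

text \<open>On the orthant the objective is quadratic, so its second-order Taylor expansion is
  exact; the penalty adds the constant vector \<open>lam *\<^sub>R 1\<close> to the
  gradient.\<close>

lemma csr_objective_expand:
  fixes A :: "real ^ 'n ^ 'k"
  assumes "0 \<le> z" and "0 \<le> w"
  shows "csr_objective A y lam w = csr_objective A y lam z
    + (transpose A *v (A *v z - y) + lam *\<^sub>R 1) \<bullet> (w - z) + 1 / 2 * (norm (A *v (w - z)))\<^sup>2"
proof -
  have "A *v w - y = (A *v z - y) + A *v (w - z)"
    by (simp add: matrix_vector_mult_diff_distrib)
  then have "(norm (A *v w - y))\<^sup>2 = (norm (A *v z - y))\<^sup>2
      + 2 * ((A *v z - y) \<bullet> (A *v (w - z))) + (norm (A *v (w - z)))\<^sup>2"
    by (simp only: power2_norm_eq_inner inner_add_left inner_add_right inner_commute)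
  then show ?thesis
    using assms
    by (simp add: csr_objective_def l1_norm_nonneg_vec inner_add_left inner_diff_right
        inner_transpose_matrix algebra_simps del: transpose_matrix_vector)
qed

text \<open>First-order optimality. For necessity, compare with
  \<open>z + t *\<^sub>R (w - z)\<close>, divide by \<open>t\<close> and let \<open>t\<close> tend
  to zero from the right; for sufficiency, the quadratic remainder is nonnegative.\<close>

lemma csr_solutions_iff_variational:
  fixes A :: "real ^ 'n ^ 'k"
  shows "z \<in> csr_solutions A y lam \<longleftrightarrow>
    0 \<le> z \<and> (\<forall>w\<ge>0. 0 \<le> (transpose A *v (A *v z - y) + lam *\<^sub>R 1) \<bullet> (w - z))"
    (is "_ \<longleftrightarrow> 0 \<le> z \<and> (\<forall>w\<ge>0. 0 \<le> ?g \<bullet> (w - z))")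
proof -
  have sol: "z \<in> csr_solutions A y lam \<longleftrightarrow>
      0 \<le> z \<and> (\<forall>w\<ge>0. csr_objective A y lam z \<le> csr_objective A y lam w)"
    by (simp add: csr_solutions_def is_arg_min_linorder)
  have "0 \<le> ?g \<bullet> (w - z)"
    if z: "0 \<le> z" and min: "\<forall>w\<ge>0. csr_objective A y lam z \<le> csr_objective A y lam w"
      and w: "0 \<le> w" for w
  proof (rule tendsto_lowerbound)
    show "((\<lambda>t. ?g \<bullet> (w - z) + t * (1 / 2 * (norm (A *v (w - z)))\<^sup>2)) \<longlongrightarrow> ?g \<bullet> (w - z))
        (at_right 0)"
      by (auto intro!: tendsto_eq_intros)
    have "0 \<le> ?g \<bullet> (w - z) + t * (1 / 2 * (norm (A *v (w - z)))\<^sup>2)"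
      if t: "0 < t" "t < 1" for t
    proof -
      have nonneg: "0 \<le> z + t *\<^sub>R (w - z)"
        unfolding less_eq_vec_def
      proof
        fix i
        have "0 \<le> (1 - t) * z $ i + t * w $ i"
          using z w t by (simp add: less_eq_vec_def)
        then show "0 $ i \<le> (z + t *\<^sub>R (w - z)) $ i"
          by (simp add: algebra_simps)
      qed
      then have "0 \<le> t * (?g \<bullet> (w - z)) + 1 / 2 * (norm (t *\<^sub>R (A *v (w - z))))\<^sup>2"
        using csr_objective_expand[OF z nonneg, of A y lam] min
        by (fastforce simp: matrix_vector_mult_scaleR simp del: transpose_matrix_vector)
      also have "\<dots> = t * (?g \<bullet> (w - z) + t * (1 / 2 * (norm (A *v (w - z)))\<^sup>2))"
        unfolding norm_scaleR by (simp add: power_mult_distrib power2_eq_square algebra_simps)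
      finally show ?thesis
        using t by (simp add: zero_le_mult_iff del: transpose_matrix_vector)
    qed
    then show "\<forall>\<^sub>F t in at_right 0. 0 \<le> ?g \<bullet> (w - z) + t * (1 / 2 * (norm (A *v (w - z)))\<^sup>2)"
      unfolding eventually_at_right_field by (intro exI[of _ 1]) simp
  qed simp
  moreover have "csr_objective A y lam z \<le> csr_objective A y lam w"
    if "0 \<le> z" "0 \<le> w" "0 \<le> ?g \<bullet> (w - z)" for w
    using csr_objective_expand[OF that(1,2), of A y lam] that(3)
      zero_le_power2[of "norm (A *v (w - z))"] by linarith
  ultimately show ?thesis unfolding sol by blast
qed

section \<open>Existence of minimizers\<close>

lemma nonneg_orthant_eq_convex_cone_hull:
  "{x :: real ^ 'n. 0 \<le> x} = convex_cone hull (range (\<lambda>i. axis i 1))"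
proof
  let ?C = "convex_cone hull (range (\<lambda>i. axis i 1)) :: (real ^ 'n) set"
  have "(\<Sum>i\<in>I. (x $ i) *\<^sub>R axis i 1) \<in> ?C" if "0 \<le> x" "finite I" for x :: "real ^ 'n" and I
    using that(2)
  proof induction
    case (insert i I)
    have "(x $ i) *\<^sub>R axis i 1 \<in> ?C"
      using that(1) by (intro convex_cone_hull_mul hull_inc) (auto simp: less_eq_vec_def)
    with insert show ?case by (simp add: convex_cone_hull_add)
  qed (simp add: convex_cone_hull_contains_0)
  from this[OF _ finite, of _ UNIV] show "{x. 0 \<le> x} \<subseteq> ?C"
    by (simp add: basis_expansion subset_iff flip: scalar_mult_eq_scaleR)
  show "?C \<subseteq> {x. 0 \<le> x}"
    by (rule hull_minimal) (auto simp: convex_cone_iff less_eq_vec_def axis_def)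
qed

text \<open>Linear images of closed sets can fail to be closed, but here the image is again a cone
  generated by finitely many vectors.\<close>

lemma closed_linear_image_nonneg_orthant:
  fixes f :: "real ^ 'n \<Rightarrow> 'a::euclidean_space"
  assumes "linear f"
  shows "closed (f ` {x. 0 \<le> x})"
  unfolding nonneg_orthant_eq_convex_cone_hull convex_cone_hull_linear_image[OF assms, symmetric]
  by (intro closed_convex_cone_hull finite_imageI finite)

lemma closed_nonneg_orthant: "closed {x :: real ^ 'n. 0 \<le> x}"
  using closed_linear_image_nonneg_orthant[OF linear_ident] by simp

lemma norm_le_l1_norm: "norm x \<le> l1_norm x"
  by (simp add: l1_norm_def norm_le_l1_cart)

lemma csr_solutions_nonempty:
  fixes A :: "real ^ 'n ^ 'k"
  assumes "lam \<ge> 0"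
  shows "csr_solutions A y lam \<noteq> {}"
proof (cases "lam = 0")
  case True
  \<comment> \<open>Sublevel sets may be unbounded when \<open>A\<close> has a kernel, so the
    minimum is sought in the image, as the point of a closed cone nearest to
    \<open>y\<close>.\<close>
  have "closed ((*v) A ` {x. 0 \<le> x})"
    by (intro closed_linear_image_nonneg_orthant matrix_vector_mul_linear)
  moreover have "(*v) A ` {x. 0 \<le> x} \<noteq> {}" by blast
  ultimately obtain b where b: "b \<in> (*v) A ` {x. 0 \<le> x}"
    "\<forall>c \<in> (*v) A ` {x. 0 \<le> x}. dist y b \<le> dist y c"
    using distance_attains_inf[of "(*v) A ` {x. 0 \<le> x}" y] by metis
  then obtain z where "0 \<le> z" and z: "\<And>w. 0 \<le> w \<Longrightarrow> dist y (A *v z) \<le> dist y (A *v w)"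
    by blast
  have "z \<in> csr_solutions A y lam"
    using \<open>0 \<le> z\<close> z True
    by (auto simp: csr_solutions_def is_arg_min_linorder csr_objective_def dist_norm
        norm_minus_commute)
  then show ?thesis by blast
next
  case False
  with assms have lam: "lam > 0" by simp
  \<comment> \<open>Outside this ball \<open>lam * norm w\<close> alone exceeds the objective at
    \<open>0\<close>, so a minimizer on \<open>S\<close> is global.\<close>
  define S where "S = {x :: real ^ 'n. 0 \<le> x} \<inter> cball 0 (csr_objective A y lam 0 / lam)"
  have "compact S"
    unfolding S_def by (intro closed_Int_compact closed_nonneg_orthant compact_cball)
  moreover have "0 \<in> S"
    using lam by (simp add: S_def csr_objective_def l1_norm_def)
  moreover have "continuous_on S (csr_objective A y lam)"
    unfolding csr_objective_def l1_norm_def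
    by (intro continuous_intros matrix_vector_mult_linear_continuous_on)
  ultimately obtain z where z: "z \<in> S" "\<And>w. w \<in> S \<Longrightarrow> csr_objective A y lam z \<le> csr_objective A y lam w"
    using continuous_attains_inf[of S] by blast
  have "csr_objective A y lam z \<le> csr_objective A y lam w" if "0 \<le> w" for w
  proof (cases "w \<in> S")
    case False
    have "csr_objective A y lam z \<le> csr_objective A y lam 0"
      using z \<open>0 \<in> S\<close> by blast
    also have "\<dots> \<le> lam * norm w"
      using False that lam by (simp add: S_def field_simps)
    also have "\<dots> \<le> lam * l1_norm w"
      using lam norm_le_l1_norm by simp
    also have "\<dots> \<le> csr_objective A y lam w"
      by (simp add: csr_objective_def)
    finally show ?thesis .
  qed (rule z)
  with z(1) have "z \<in> csr_solutions A y lam"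
    by (auto simp: csr_solutions_def is_arg_min_linorder S_def)
  then show ?thesis by blast
qed

section \<open>Convergence\<close>

text \<open>The second assumption says that the resolvent maps \<open>2 *\<^sub>R z - v\<close> to
  \<open>z\<close>. It turns the gradient at \<open>z\<close> into a negative multiple of
  \<open>v - (lam / \<mu>) *\<^sub>R 1 - z\<close>, so optimality becomes the projection
  inequality.\<close>

lemma csr_solutions_iff_pos_part:
  fixes A :: "real ^ 'n ^ 'k"
  assumes "\<mu> > 0"
    and "transpose A *v (A *v z) + \<mu> *\<^sub>R z = transpose A *v y + \<mu> *\<^sub>R (2 *\<^sub>R z - v)"
  shows "z \<in> csr_solutions A y lam \<longleftrightarrow> pos_part (v - (lam / \<mu>) *\<^sub>R 1) = z"
proof -
  let ?a = "v - (lam / \<mu>) *\<^sub>R 1"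
  have "transpose A *v (A *v z - y) = \<mu> *\<^sub>R (2 *\<^sub>R z - v) - \<mu> *\<^sub>R z"
    by (simp only: matrix_vector_mult_diff_distrib eq_diff_eq diff_add_eq assms(2)
        add_diff_cancel_left')
  also have "\<dots> = \<mu> *\<^sub>R (z - v)"
    by (simp add: vec_eq_iff algebra_simps)
  finally have "transpose A *v (A *v z - y) + lam *\<^sub>R 1 = - \<mu> *\<^sub>R (?a - z)"
    using assms(1) by (simp add: algebra_simps del: transpose_matrix_vector)
  then have "z \<in> csr_solutions A y lam \<longleftrightarrow> 0 \<le> z \<and> (\<forall>w\<ge>0. (?a - z) \<bullet> (w - z) \<le> 0)"
    using assms(1) unfolding csr_solutions_iff_variational
    by (simp only: inner_scaleR_left) (simp add: mult_le_0_iff)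
  also have "\<dots> \<longleftrightarrow> pos_part ?a = z"
    using pos_part_unique pos_part_nonneg pos_part_inner_le by blast
  finally show ?thesis .
qed

theorem mainTheorem1:
  fixes A :: "real ^ 'n ^ 'k" and y :: "real ^ 'k" and lam \<mu> :: real
  assumes "lam \<ge> 0" and "\<mu> > 0"
  shows "csr_solutions A y lam \<noteq> {} \<and>
    (\<forall>u0 d0 :: real ^ 'n. \<forall>x u d. sunsal_iteration A y lam \<mu> u0 d0 x u d \<longrightarrow>
       (\<exists>z \<in> csr_solutions A y lam. x \<longlonglongrightarrow> z))"
proof (intro conjI allI impI)
  show "csr_solutions A y lam \<noteq> {}"
    using assms(1) by (rule csr_solutions_nonempty)
  then obtain z\<^sub>0 where z0: "z\<^sub>0 \<in> csr_solutions A y lam" by blast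
  fix u0 d0 :: "real ^ 'n" and x u d
  assume it: "sunsal_iteration A y lam \<mu> u0 d0 x u d"
  define P :: "real ^ 'n \<Rightarrow> real ^ 'n" where "P v = pos_part (v - (lam / \<mu>) *\<^sub>R 1)" for v
  define R where "R q = matrix_inv (transpose A ** A + \<mu> *\<^sub>R mat 1) *v
      (transpose A *v y + \<mu> *\<^sub>R q)" for q
  define T where "T v = R (2 *\<^sub>R P v - v) + v - P v" for v
  define v where "v j = x (Suc j) - d j" for j
  have P: "firmly_nonexpansive P"
    unfolding P_def by (rule firmly_nonexpansive_pos_part_shift)
  have R: "firmly_nonexpansive R"
    unfolding R_def using assms(2) by (rule firmly_nonexpansive_gram_resolvent)
  have T: "firmly_nonexpansive T"
    unfolding T_def using P R by (rule firmly_nonexpansive_Douglas_Rachford)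
  have R_eq: "R q = z \<longleftrightarrow>
      transpose A *v (A *v z) + \<mu> *\<^sub>R z = transpose A *v y + \<mu> *\<^sub>R q" for q z
    unfolding R_def using assms(2) by (rule matrix_inv_gram_shift_eq_iff)
  have sol_iff: "z \<in> csr_solutions A y lam \<longleftrightarrow> P v = z" if "R (2 *\<^sub>R z - v) = z" for z v
    using csr_solutions_iff_pos_part[OF assms(2)] that unfolding R_eq P_def by blast

  have x_Suc: "x (Suc j) = R (u j + d j)" for j
    using it by (simp add: sunsal_iteration_def R_def)
  have u_Suc: "u (Suc j) = P (v j)" for j
    using it assms by (simp add: sunsal_iteration_def P_def v_def pos_part_soft)
  have d_Suc: "d (Suc j) = P (v j) - v j" for j
    using it u_Suc[of j] by (simp add: sunsal_iteration_def v_def)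
  \<comment> \<open>Only from index 1 on is \<open>u j + d j\<close> a function of the
    \<open>v\<close> sequence; the arbitrary \<open>u0\<close> and \<open>d0\<close> enter through
    \<open>v 0\<close>.\<close>
  have x_Suc_Suc: "x (Suc (Suc j)) = R (2 *\<^sub>R P (v j) - v j)" for j
    by (simp add: x_Suc u_Suc d_Suc scaleR_2 add_diff_eq)
  have v_Suc: "v (Suc j) = T (v j)" for j
    by (subst v_def) (simp add: T_def x_Suc_Suc d_Suc)

  \<comment> \<open>Found by solving \<open>R (2 *\<^sub>R z\<^sub>0 - v) = z\<^sub>0\<close> for
    \<open>v\<close>; optimality of \<open>z\<^sub>0\<close> then gives
    \<open>P v\<^sub>0 = z\<^sub>0\<close>.\<close>
  define v\<^sub>0 where "v\<^sub>0 = z\<^sub>0 - (1 / \<mu>) *\<^sub>R (transpose A *v (A *v z\<^sub>0 - y))"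
  have "\<mu> *\<^sub>R (2 *\<^sub>R z\<^sub>0 - v\<^sub>0) = \<mu> *\<^sub>R z\<^sub>0 + transpose A *v (A *v z\<^sub>0 - y)"
    using assms(2) by (simp add: v\<^sub>0_def vec_eq_iff algebra_simps del: transpose_matrix_vector)
  then have "R (2 *\<^sub>R z\<^sub>0 - v\<^sub>0) = z\<^sub>0"
    unfolding R_eq by (simp add: matrix_vector_mult_diff_distrib del: transpose_matrix_vector)
  with z0 sol_iff have "T v\<^sub>0 = v\<^sub>0"
    by (simp add: T_def)
  with T obtain q where q: "T q = q" "v \<longlonglongrightarrow> q"
    using v_Suc by (rule firmly_nonexpansive_iterates_converge)
  from q(1) have Rq: "R (2 *\<^sub>R P q - q) = P q"
    by (simp add: T_def algebra_simps)
  have "(\<lambda>j. x (Suc (Suc j))) \<longlonglongrightarrow> R (2 *\<^sub>R P q - q)"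
    unfolding x_Suc_Suc
    by (intro firmly_nonexpansive_tendsto[OF R] tendsto_intros firmly_nonexpansive_tendsto[OF P] q(2))
  then have "x \<longlonglongrightarrow> P q"
    by (simp add: Rq LIMSEQ_imp_Suc)
  \<comment> \<open>For \<open>z = P q\<close> and \<open>v = q\<close> the right-hand side of
    \<open>sol_iff\<close> is reflexivity.\<close>
  moreover have "P q \<in> csr_solutions A y lam"
    using sol_iff[OF Rq] by simp
  ultimately show "\<exists>z \<in> csr_solutions A y lam. x \<longlonglongrightarrow> z" by blast
qed

end
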